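(* The four cardinals $\mathfrak{f}$, $\mathfrak{f}_1$, $\mathfrak{f}_2$ and $\mathfrak{e}_{ubd}$ (defined in the context) are equal: $\mathfrak{f} = \mathfrak{f}_1 = \mathfrak{f}_2 = \mathfrak{e}_{ubd}$.
   Context: Notation: $\omega$ is the set of natural numbers, ${}^{\omega}\omega$ the set of functions $\omega\to\omega$, ${}^{n}\omega$ the set of sequences of natural numbers of length $n$, $[\omega]^{\omega}$ the set of infinite subsets of $\omega$, and $[\omega]^{\leq m}$ the set of subsets of $\omega$ of size at most $m$. $\exists^\infty n$ means "there are infinitely many $n$". For $X,Y\subseteq\omega$, $X\subseteq^* Y$ means that $X\setminus Y$ is finite. $\mathcal{P}(\omega)$ is identified with ${}^{\omega}2$ via characteristic functions and carries the product topology of the discrete space $\{0,1\}$; "F$_\sigma$" (countable union of closed sets) refers to this topology. A filter is a collection of subsets of $\omega$ closed under finite intersections and supersets and containing all cofinite sets; all filters are assumed proper, i.e. they contain only infinite sets. The filter generated by $\mathcal{X}\subseteq[\omega]^\omega$ is the smallest filter containing each member of $\mathcal{X}$. An infinite set $X\in[\omega]^\omega$ diagonalizes a filter $\mathcal{F}$ if $X\subseteq^* Y$ for every $Y\in\mathcal{F}$. A filter is non trivial if no single infinite set diagonalizes it. A family $\mathcal{H}\subseteq{}^{\omega}\omega$ is bounded if there is $b\in{}^{\omega}\omega$ such that for every $h\in\mathcal{H}$, $h(n)\leq b(n)$ for all but finitely many $n$. Definitions of the cardinals: - $\mathfrak{f}$ is the minimum of $|\mathcal{X}|$ over all $\mathcal{X}\subseteq[\omega]^{\omega}$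 that generate a non trivial filter included in some F$_\sigma$ filter. - $\mathfrak{f}_1$ is the minimum of $|\mathcal{H}|$ over all bounded $\mathcal{H}\subseteq{}^{\omega}\omega$ such that for some $g\in{}^{\omega}\omega$ with $\lim_{n\to\infty}g(n)=\infty$: for every $X\in[\omega]^{\omega}$ and every sequence $\langle s_n : n\in\omega\rangle$ with $s_n\in[\omega]^{\leq g(n)}$, there is $h\in\mathcal{H}$ with $(\exists^\infty n\in X)\; h(n)\notin s_n$. - $\mathfrak{f}_2$ is the minimum of $|\mathcal{H}|$ over all bounded $\mathcal{H}\subseteq{}^{\omega}\omega$ such that for some $g\in{}^{\omega}\omega$ with $\lim_{n\to\infty}g(n)=\infty$: for every $X\in[\omega]^{\omega}$ and every sequence of functions $\pi_n:{}^{n}\omega\to[\omega]^{\leq g(n)}$ ($n\in\omega$), there is $h\in\mathcal{H}$ with $(\exists^\infty n\in X)\; h(n)\notin\pi_n(h\restriction n)$. - $\mathfrak{e}_{ubd}$ is the minimum of $|\mathcal{H}|$ over all bounded $\mathcal{H}\subseteq{}^{\omega}\omega$ such that for every $X\in[\omega]^{\omega}$ and every sequence of functions $\pi_n:{}^{n}\omega\to\omega$ ($n\in\omega$), there is $h\in\mathcal{H}$ with $(\exists^\infty n\in X)\; h(n)\neq\pi_n(h\restriction n)$. *)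

theory Defs
  imports "HOL-Analysis.Analysis"
begin

section \<open>Least cardinality of a family with a given property\<close>

text \<open>
  Cardinals are represented, as in the BNF cardinal theory of Main, by cardinal orders, and are
  compared by \<open>\<le>o\<close> and \<open>=o\<close>.  The chosen witness (hence the cardinal order) is unique only up
  to \<open>=o\<close>, and the definition is meaningful only for satisfiable \<^term>\<open>P\<close>; satisfiability is
  proved below for each of the four properties it is used with.
\<close>

unbundle cardinal_syntax

definition min_card :: "('a set \<Rightarrow> bool) \<Rightarrow> 'a rel" where
  "min_card P = |SOME X. P X \<and> (\<forall>Y. P Y \<longrightarrow> |X| \<le>o |Y| )|"

lemma min_card_attained:
  assumes "P X0"
  obtains X where "P X" "min_card P = |X|" "\<And>Y. P Y \<Longrightarrow> |X| \<le>o |Y|"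
proof -
  have "card_of ` Collect P \<noteq> {}" "\<forall>r \<in> card_of ` Collect P. Card_order r"
    using assms card_of_Card_order by auto
  from exists_minim_Card_order[OF this]
  have "\<exists>X. P X \<and> (\<forall>Y. P Y \<longrightarrow> |X| \<le>o |Y| )" by auto
  from someI_ex[OF this] that show ?thesis unfolding min_card_def by blast
qed


section \<open>Filters on the natural numbers\<close>

definition omega_filter :: "nat set set \<Rightarrow> bool" where
  "omega_filter F \<longleftrightarrow>
     (\<forall>A\<in>F. \<forall>B\<in>F. A \<inter> B \<in> F) \<and>
     (\<forall>A\<in>F. \<forall>B. A \<subseteq> B \<longrightarrow> B \<in> F) \<and>
     (\<forall>A. finite (- A) \<longrightarrow> A \<in> F) \<and>
     (\<forall>A\<in>F. infinite A)"

text \<open>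
  If no filter contains \<^term>\<open>\<X>\<close>, then this intersection is \<^term>\<open>UNIV\<close>, which is not a filter.
\<close>

definition generated_filter :: "nat set set \<Rightarrow> nat set set" where
  "generated_filter \<X> = \<Inter> {F. omega_filter F \<and> \<X> \<subseteq> F}"

definition almost_subset :: "nat set \<Rightarrow> nat set \<Rightarrow> bool" (infix \<open>\<subseteq>\<^sup>*\<close> 50) where
  "X \<subseteq>\<^sup>* Y \<longleftrightarrow> finite (X - Y)"

definition diagonalizes :: "nat set \<Rightarrow> nat set set \<Rightarrow> bool" where
  "diagonalizes X F \<longleftrightarrow> infinite X \<and> (\<forall>Y\<in>F. X \<subseteq>\<^sup>* Y)"

definition nontrivial_filter :: "nat set set \<Rightarrow> bool" where
  "nontrivial_filter F \<longleftrightarrow> omega_filter F \<and> (\<nexists>X. diagonalizes X F)"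

definition cantor_space :: "(nat \<Rightarrow> bool) topology" where
  "cantor_space = product_topology (\<lambda>_. discrete_topology UNIV) UNIV"

definition fsigma_filter :: "nat set set \<Rightarrow> bool" where
  "fsigma_filter F \<longleftrightarrow> omega_filter F \<and> fsigma_in cantor_space ((\<lambda>A n. n \<in> A) ` F)"


section \<open>The four cardinals\<close>

definition bounded_family :: "(nat \<Rightarrow> nat) set \<Rightarrow> bool" where
  "bounded_family H \<longleftrightarrow> (\<exists>b. \<forall>h\<in>H. \<forall>\<^sub>\<infinity>n. h n \<le> b n)"

definition f_family :: "nat set set \<Rightarrow> bool" where
  "f_family \<X> \<longleftrightarrow>
     (\<forall>A\<in>\<X>. infinite A) \<and>
     nontrivial_filter (generated_filter \<X>) \<and>
     (\<exists>G. fsigma_filter G \<and> generated_filter \<X> \<subseteq> G)"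

definition f1_family :: "(nat \<Rightarrow> nat) set \<Rightarrow> bool" where
  "f1_family H \<longleftrightarrow> bounded_family H \<and>
     (\<exists>g :: nat \<Rightarrow> nat. filterlim g at_top sequentially \<and>
       (\<forall>(X :: nat set) (s :: nat \<Rightarrow> nat set).
          infinite X \<and> (\<forall>n. finite (s n) \<and> card (s n) \<le> g n) \<longrightarrow>
          (\<exists>h\<in>H. \<exists>\<^sub>\<infinity>n. n \<in> X \<and> h n \<notin> s n)))"

text \<open>
  Sequences of length \<open>n\<close> are lists of length \<open>n\<close>, and \<^term>\<open>map h [0..<n]\<close> is the restriction
  of \<open>h\<close> to \<open>n\<close>.  The values of \<open>\<pi> n\<close> on lists of any other length are irrelevant.
\<close>

definition f2_family :: "(nat \<Rightarrow> nat) set \<Rightarrow> bool" where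
  "f2_family H \<longleftrightarrow> bounded_family H \<and>
     (\<exists>g :: nat \<Rightarrow> nat. filterlim g at_top sequentially \<and>
       (\<forall>(X :: nat set) (\<pi> :: nat \<Rightarrow> nat list \<Rightarrow> nat set).
          infinite X \<and>
          (\<forall>n t. length t = n \<longrightarrow> finite (\<pi> n t) \<and> card (\<pi> n t) \<le> g n) \<longrightarrow>
          (\<exists>h\<in>H. \<exists>\<^sub>\<infinity>n. n \<in> X \<and> h n \<notin> \<pi> n (map h [0..<n]))))"

definition e_ubd_family :: "(nat \<Rightarrow> nat) set \<Rightarrow> bool" where
  "e_ubd_family H \<longleftrightarrow> bounded_family H \<and>
     (\<forall>(X :: nat set) (\<pi> :: nat \<Rightarrow> nat list \<Rightarrow> nat).
        infinite X \<longrightarrow>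
        (\<exists>h\<in>H. \<exists>\<^sub>\<infinity>n. n \<in> X \<and> h n \<noteq> \<pi> n (map h [0..<n])))"

definition card_f :: "nat set rel" where
  "card_f = min_card f_family"

definition card_f1 :: "(nat \<Rightarrow> nat) rel" where
  "card_f1 = min_card f1_family"

definition card_f2 :: "(nat \<Rightarrow> nat) rel" where
  "card_f2 = min_card f2_family"

definition card_e_ubd :: "(nat \<Rightarrow> nat) rel" where
  "card_e_ubd = min_card e_ubd_family"


section \<open>The minima are attained\<close>

text \<open>
  A nontrivial \<open>F\<^sub>\<sigma>\<close> filter: the sets whose complements have boundedly many elements in each
  dyadic block.
\<close>

definition dyadic_block :: "nat \<Rightarrow> nat set" where
  "dyadic_block m = {2 ^ m..<2 ^ Suc m}"

definition dyadic_filter :: "nat set set" where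
  "dyadic_filter = {A. \<exists>k. \<forall>m. card (dyadic_block m - A) \<le> k}"

lemma finite_dyadic_block [simp]: "finite (dyadic_block m)"
  by (simp add: dyadic_block_def)

lemma omega_filter_dyadic: "omega_filter dyadic_filter"
  unfolding omega_filter_def
proof (intro conjI ballI allI impI)
  fix A B assume "A \<in> dyadic_filter" "B \<in> dyadic_filter"
  then obtain k l where kl: "\<And>m. card (dyadic_block m - A) \<le> k" "\<And>m. card (dyadic_block m - B) \<le> l"
    by (auto simp: dyadic_filter_def)
  have "card (dyadic_block m - A \<inter> B) \<le> k + l" for m
  proof -
    have "dyadic_block m - A \<inter> B = (dyadic_block m - A) \<union> (dyadic_block m - B)" by blast
    then show ?thesis
      using card_Un_le[of "dyadic_block m - A" "dyadic_block m - B"] kl[of m] by simp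
  qed
  then show "A \<inter> B \<in> dyadic_filter" by (auto simp: dyadic_filter_def)
next
  fix A B assume "A \<in> dyadic_filter" "A \<subseteq> B"
  then obtain k where k: "\<And>m. card (dyadic_block m - A) \<le> k" by (auto simp: dyadic_filter_def)
  have "card (dyadic_block m - B) \<le> k" for m
    using card_mono[of "dyadic_block m - A" "dyadic_block m - B"] \<open>A \<subseteq> B\<close> k[of m]
    by (meson Diff_mono finite_Diff finite_dyadic_block order_refl order_trans)
  then show "B \<in> dyadic_filter" by (auto simp: dyadic_filter_def)
next
  fix A :: "nat set" assume "finite (- A)"
  then have "card (dyadic_block m - A) \<le> card (- A)" for m by (intro card_mono) auto
  then show "A \<in> dyadic_filter" by (auto simp: dyadic_filter_def)
next
  fix A assume "A \<in> dyadic_filter"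
  then obtain k where k: "\<And>m. card (dyadic_block m - A) \<le> k" by (auto simp: dyadic_filter_def)
  show "infinite A"
  proof
    assume "finite A"
    then obtain N where N: "\<And>n. n \<in> A \<Longrightarrow> n < N" by (auto simp: finite_nat_set_iff_bounded)
    define m where "m = k + N"
    have m: "m < 2 ^ m" "k \<le> m" "N \<le> m" unfolding m_def by simp_all
    have "x \<notin> A" if "x \<in> dyadic_block m" for x
    proof
      assume "x \<in> A"
      then have "x < N" by (rule N)
      moreover have "2 ^ m \<le> x" using that by (simp add: dyadic_block_def)
      ultimately show False using m by linarith
    qed
    then have "dyadic_block m - A = dyadic_block m" by blast
    then have "card (dyadic_block m) \<le> k" using k[of m] by (simp only:)
    moreover have "card (dyadic_block m) = 2 ^ m" by (simp add: dyadic_block_def)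
    ultimately show False using m by linarith
  qed
qed

lemma nontrivial_dyadic: "nontrivial_filter dyadic_filter"
  unfolding nontrivial_filter_def
proof (intro conjI notI omega_filter_dyadic)
  assume "\<exists>X. diagonalizes X dyadic_filter"
  then obtain X where X: "infinite X" "\<And>Y. Y \<in> dyadic_filter \<Longrightarrow> finite (X - Y)"
    by (auto simp: diagonalizes_def almost_subset_def)
  define S where "S = {x \<in> X. \<forall>y\<in>X. y < x \<longrightarrow> (\<exists>j. y < 2 ^ j \<and> 2 ^ j \<le> x)}"
  have "card (dyadic_block m - (- S)) \<le> 1" for m
  proof -
    have False if xy: "x \<in> dyadic_block m" "y \<in> dyadic_block m" "x \<in> S" "y \<in> S" "y < x" for x y
    proof -
      obtain j :: nat where j: "y < 2 ^ j" "2 ^ j \<le> x" using xy by (auto simp: S_def)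
      have b: "2 ^ m \<le> y" "x < 2 ^ Suc m" using xy by (auto simp: dyadic_block_def)
      have "(2::nat) ^ m < 2 ^ j" using b(1) j(1) by (rule le_less_trans)
      moreover have "(2::nat) ^ j < 2 ^ Suc m" using j(2) b(2) by (rule le_less_trans)
      ultimately have "m < j" "j < Suc m"
        by (simp_all only: power_strict_increasing_iff[of "2::nat"] one_less_numeral_iff semiring_norm(76))
      then show False by simp
    qed
    then have "\<forall>x \<in> dyadic_block m - (- S). \<forall>y \<in> dyadic_block m - (- S). x = y"
      by (metis ComplI DiffE linorder_neqE_nat)
    then show ?thesis by (simp add: card_le_Suc0_iff_eq)
  qed
  then have "- S \<in> dyadic_filter" unfolding dyadic_filter_def by blast
  then have "finite (X - (- S))" by (rule X)
  moreover have "X - (- S) = S" by (auto simp: S_def)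
  moreover have "infinite S"
    unfolding infinite_nat_iff_unbounded_le
  proof
    fix m :: nat
    define x where "x = (LEAST x. x \<in> X \<and> 2 ^ m \<le> x)"
    have "\<exists>x. x \<in> X \<and> 2 ^ m \<le> x" using X(1) by (auto simp: infinite_nat_iff_unbounded_le)
    then have x: "x \<in> X" "2 ^ m \<le> x" unfolding x_def by (metis (mono_tags, lifting) LeastI_ex)+
    have "y < 2 ^ m" if "y \<in> X" "y < x" for y
      using that not_less_Least[of y "\<lambda>x. x \<in> X \<and> 2 ^ m \<le> x"] by (auto simp: x_def)
    then have "x \<in> S" using x by (auto simp: S_def)
    moreover have "m \<le> x" using x less_exp[of m] by linarith
    ultimately show "\<exists>n\<ge>m. n \<in> S" by blast
  qed
  ultimately show False by simp
qed

lemma fsigma_filter_dyadic: "fsigma_filter dyadic_filter"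
proof -
  define C where "C k = {u. \<forall>m T. T \<subseteq> dyadic_block m \<and> card T > k \<longrightarrow> (\<exists>n\<in>T. u n)}" for k
  have closed_C: "closed (C k)" for k
  proof -
    have "closed {u :: nat \<Rightarrow> bool. u n}" for n
    proof -
      have "closed ((\<lambda>u :: nat \<Rightarrow> bool. u n) -` {True})"
        by (intro closed_vimage continuous_on_product_coordinates) (auto simp: closed_def open_discrete)
      then show ?thesis by (simp add: vimage_def)
    qed
    then have "closed (\<Union>n\<in>T. {u :: nat \<Rightarrow> bool. u n})" if "T \<subseteq> dyadic_block m" for T m
      using that by (intro closed_UN finite_subset[OF that]) auto
    moreover have "C k = (\<Inter>m. \<Inter>T \<in> {T. T \<subseteq> dyadic_block m \<and> card T > k}. \<Union>n\<in>T. {u. u n})"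
      by (auto simp: C_def)
    ultimately show ?thesis by (simp only:) (intro closed_INT ballI, auto)
  qed
  have iff: "(\<forall>m. card (dyadic_block m - A) \<le> k) \<longleftrightarrow> (\<lambda>n. n \<in> A) \<in> C k" for A k
  proof
    assume L: "\<forall>m. card (dyadic_block m - A) \<le> k"
    have "\<exists>n\<in>T. n \<in> A" if "T \<subseteq> dyadic_block m" "card T > k" for T m
    proof (rule ccontr)
      assume "\<not> ?thesis"
      then have "card T \<le> card (dyadic_block m - A)" using that by (intro card_mono) auto
      then show False using that L by (meson leD order_trans)
    qed
    then show "(\<lambda>n. n \<in> A) \<in> C k" by (auto simp: C_def)
  next
    assume R: "(\<lambda>n. n \<in> A) \<in> C k"
    show "\<forall>m. card (dyadic_block m - A) \<le> k"
    proof (rule allI, rule ccontr)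
      fix m assume "\<not> card (dyadic_block m - A) \<le> k"
      then have "k < card (dyadic_block m - A)" by simp
      moreover have "\<forall>m T. T \<subseteq> dyadic_block m \<and> k < card T \<longrightarrow> (\<exists>n\<in>T. n \<in> A)"
        using R by (simp add: C_def)
      ultimately have "\<exists>n \<in> dyadic_block m - A. n \<in> A" by (meson Diff_subset)
      then show False by blast
    qed
  qed
  have "(\<lambda>A n. n \<in> A) ` dyadic_filter = (\<Union>k. C k)"
  proof
    show "(\<lambda>A n. n \<in> A) ` dyadic_filter \<subseteq> (\<Union>k. C k)"
      using iff by (auto simp: dyadic_filter_def)
    show "(\<Union>k. C k) \<subseteq> (\<lambda>A n. n \<in> A) ` dyadic_filter"
    proof
      fix u assume "u \<in> (\<Union>k. C k)"
      then obtain k where "(\<lambda>n. n \<in> Collect u) \<in> C k" by auto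
      then have "Collect u \<in> dyadic_filter" unfolding iff[symmetric] dyadic_filter_def by blast
      then show "u \<in> (\<lambda>A n. n \<in> A) ` dyadic_filter" by (force intro: image_eqI[of _ _ "Collect u"])
    qed
  qed
  moreover have "cantor_space = euclidean"
  proof -
    have "discrete_topology (UNIV :: bool set) = euclidean"
      by (simp add: topology_eq open_discrete)
    then show ?thesis by (simp add: cantor_space_def euclidean_product_topology)
  qed
  moreover have "fsigma_in euclidean (\<Union>k. C k)"
    by (intro fsigma_in_Union) (auto intro: closed_imp_fsigma_in simp: closed_C)
  ultimately show ?thesis by (simp add: fsigma_filter_def omega_filter_dyadic)
qed

lemma f_family_exists: "f_family dyadic_filter"
proof -
  have "generated_filter dyadic_filter = dyadic_filter"
    using omega_filter_dyadic by (auto simp: generated_filter_def)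
  moreover have "\<forall>A\<in>dyadic_filter. infinite A"
    using omega_filter_dyadic unfolding omega_filter_def by blast
  ultimately show ?thesis
    using nontrivial_dyadic fsigma_filter_dyadic unfolding f_family_def by auto
qed

text \<open>Any local prediction by at most \<open>n + 1\<close> values is evaded everywhere by some \<open>h\<close> bounded
  by \<open>n + 1\<close>.\<close>

lemma evading_function:
  fixes \<pi> :: "nat \<Rightarrow> nat list \<Rightarrow> nat set"
  assumes "\<And>n t. length t = n \<Longrightarrow> finite (\<pi> n t) \<and> card (\<pi> n t) \<le> Suc n"
  obtains h where "\<And>n. h n \<le> Suc n" "\<And>n. h n \<notin> \<pi> n (map h [0..<n])"
proof -
  define c where "c n t = (LEAST x. x \<notin> \<pi> n t)" for n t
  have c: "c n t \<notin> \<pi> n t \<and> c n t \<le> Suc n" if "length t = n" for n t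
  proof -
    have "\<not> {..Suc n} \<subseteq> \<pi> n t"
      using card_mono[of "\<pi> n t" "{..Suc n}"] assms[OF that] by auto
    then obtain x where x: "x \<le> Suc n" "x \<notin> \<pi> n t" by auto
    then show ?thesis
      using LeastI[of "\<lambda>x. x \<notin> \<pi> n t" x] Least_le[of "\<lambda>x. x \<notin> \<pi> n t" x] by (auto simp: c_def)
  qed
  define L where "L = rec_nat [] (\<lambda>n t. t @ [c n t])"
  have L: "L 0 = []" "L (Suc n) = L n @ [c n (L n)]" for n by (simp_all add: L_def)
  define h where "h n = c n (L n)" for n
  have "map h [0..<n] = L n" for n by (induction n) (simp_all add: L h_def)
  moreover have "length (L n) = n" for n by (induction n) (simp_all add: L)
  ultimately show ?thesis using that[of h] c by (simp add: h_def)
qed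

lemma f2_family_exists: "f2_family {h. \<forall>n. h n \<le> Suc n}"
  unfolding f2_family_def
proof (intro conjI exI[of _ Suc] allI impI)
  show "bounded_family {h. \<forall>n. h n \<le> Suc n}"
    unfolding bounded_family_def by (intro exI[of _ Suc]) auto
  show "filterlim Suc at_top sequentially" by (rule filterlim_Suc)
  fix X :: "nat set" and \<pi> :: "nat \<Rightarrow> nat list \<Rightarrow> nat set"
  assume *: "infinite X \<and> (\<forall>n t. length t = n \<longrightarrow> finite (\<pi> n t) \<and> card (\<pi> n t) \<le> Suc n)"
  then obtain h where "\<And>n. h n \<le> Suc n" "\<And>n. h n \<notin> \<pi> n (map h [0..<n])"
    using evading_function[of \<pi>] by blast
  with * show "\<exists>h\<in>{h. \<forall>n. h n \<le> Suc n}. \<exists>\<^sub>\<infinity>n. n \<in> X \<and> h n \<notin> \<pi> n (map h [0..<n])"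
    by (auto simp: frequently_cofinite intro!: exI[of _ h])
qed

lemma f1_family_exists: "f1_family {h. \<forall>n. h n \<le> Suc n}"
  unfolding f1_family_def
proof (intro conjI exI[of _ Suc] allI impI)
  show "bounded_family {h. \<forall>n. h n \<le> Suc n}"
    using f2_family_exists by (simp add: f2_family_def)
  show "filterlim Suc at_top sequentially" by (rule filterlim_Suc)
  fix X :: "nat set" and s :: "nat \<Rightarrow> nat set"
  assume *: "infinite X \<and> (\<forall>n. finite (s n) \<and> card (s n) \<le> Suc n)"
  then obtain h where "\<And>n. h n \<le> Suc n" "\<And>n. h n \<notin> s n"
    using evading_function[of "\<lambda>n _. s n"] by blast
  with * show "\<exists>h\<in>{h. \<forall>n. h n \<le> Suc n}. \<exists>\<^sub>\<infinity>n. n \<in> X \<and> h n \<notin> s n"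
    by (auto simp: frequently_cofinite intro!: exI[of _ h])
qed

lemma e_ubd_family_exists: "e_ubd_family {h. \<forall>n. h n \<le> Suc n}"
  unfolding e_ubd_family_def
proof (intro conjI allI impI)
  show "bounded_family {h. \<forall>n. h n \<le> Suc n}"
    using f2_family_exists by (simp add: f2_family_def)
  fix X :: "nat set" and \<pi> :: "nat \<Rightarrow> nat list \<Rightarrow> nat"
  assume X: "infinite X"
  obtain h where "\<And>n. h n \<le> Suc n" "\<And>n. h n \<notin> {\<pi> n (map h [0..<n])}"
    using evading_function[of "\<lambda>n t. {\<pi> n t}"] by auto
  with X show "\<exists>h\<in>{h. \<forall>n. h n \<le> Suc n}. \<exists>\<^sub>\<infinity>n. n \<in> X \<and> h n \<noteq> \<pi> n (map h [0..<n])"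
    by (auto simp: frequently_cofinite intro!: exI[of _ h])
qed

end

theory Submission
  imports Defs
begin

text \<open>
  The cardinals are compared along \<open>\<ff>\<^sub>1 \<le> \<ee>\<^sub>u\<^sub>b\<^sub>d \<le> \<ff>\<^sub>2 \<le> \<ff>\<^sub>1\<close> and \<open>\<ff> \<le> \<ff>\<^sub>1 \<le> \<ff>\<close>, each time by turning a
  family of one kind into a family of the other that is at most as large. Bounded functions recode
  other finite data: restrictions of functions to intervals, values along a sparse sequence, and
  traces on intervals of the sets in a filter.  An \<open>F\<^sub>\<sigma>\<close> filter is \<open>\<sigma>\<close>-compact, which yields
  intervals on which any \<open>n\<close> sets from its \<open>n\<close>-th compact piece have a common point.
\<close>

section \<open>Comparing minimal cardinalities\<close>

lemma min_card_mono:
  assumes "P X0" and "\<And>X. P X \<Longrightarrow> \<exists>Y. Q Y \<and> |Y| \<le>o |X|"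
  shows "min_card Q \<le>o min_card P"
proof -
  obtain X where X: "P X" "min_card P = |X|" using min_card_attained[of P X0] assms(1) by metis
  obtain Y where Y: "Q Y" "|Y| \<le>o |X|" using assms(2)[OF X(1)] by blast
  obtain Z where "min_card Q = |Z|" "\<And>Y. Q Y \<Longrightarrow> |Z| \<le>o |Y|"
    using min_card_attained[of Q Y] Y(1) by metis
  then show ?thesis using Y X(2) ordLeq_transitive by metis
qed


text \<open>Used to return from positions such as \<open>j n\<close> or \<open>x n\<close> to their
  indices \<open>n\<close>: finitely many indices have only finitely many images.\<close>

lemma frequently_cofinite_image:
  assumes "\<exists>\<^sub>\<infinity>y. P y" "{y. P y} \<subseteq> f ` {n. Q n}"
  shows "\<exists>\<^sub>\<infinity>n. Q n"
  using assms unfolding frequently_cofinite by (meson finite_imageI finite_subset)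


section \<open>Prediction by slaloms and prediction of single values\<close>

text \<open>A single guess is a slalom value of size one, admissible wherever \<open>g n\<close> is
  at least 1, hence at almost all \<open>n\<close>.\<close>

lemma e_ubd_family_if_f2_family:
  assumes "f2_family H"
  shows "e_ubd_family H"
  unfolding e_ubd_family_def
proof (intro conjI allI impI)
  show "bounded_family H" using assms by (simp add: f2_family_def)
  fix X :: "nat set" and \<pi> :: "nat \<Rightarrow> nat list \<Rightarrow> nat"
  assume X: "infinite X"
  obtain g :: "nat \<Rightarrow> nat" where g: "filterlim g at_top sequentially"
    and *: "\<And>X \<pi>. infinite X \<Longrightarrow>
      (\<forall>n t. length t = n \<longrightarrow> finite (\<pi> n t) \<and> card (\<pi> n t) \<le> g n) \<Longrightarrow>
      \<exists>h\<in>H. \<exists>\<^sub>\<infinity>n. n \<in> X \<and> h n \<notin> \<pi> n (map h [0..<n])"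
    using assms unfolding f2_family_def by blast
  have "\<exists>h\<in>H. \<exists>\<^sub>\<infinity>n. n \<in> X \<and> h n \<notin> (if 1 \<le> g n then {\<pi> n (map h [0..<n])} else {})"
    using *[OF X, of "\<lambda>n t. if 1 \<le> g n then {\<pi> n t} else {}"] by simp
  then obtain h where h: "h \<in> H"
    "\<exists>\<^sub>\<infinity>n. n \<in> X \<and> h n \<notin> (if 1 \<le> g n then {\<pi> n (map h [0..<n])} else {})" by blast
  have "eventually (\<lambda>n. 1 \<le> g n) cofinite"
    using g by (simp add: filterlim_at_top cofinite_eq_sequentially)
  from frequently_eventually_frequently[OF h(2) this]
  have "\<exists>\<^sub>\<infinity>n. n \<in> X \<and> h n \<noteq> \<pi> n (map h [0..<n])" by (rule frequently_elim1) auto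
  with h(1) show "\<exists>h\<in>H. \<exists>\<^sub>\<infinity>n. n \<in> X \<and> h n \<noteq> \<pi> n (map h [0..<n])" by blast
qed

text \<open>Along a sufficiently sparse sequence \<open>j\<close>, all possible pasts together admit fewer guesses
  than \<open>g\<close> allows, so a prediction that depends on the past becomes one that does not.\<close>

lemma f2_family_from_f1_family:
  assumes "f1_family H"
  shows "\<exists>H'. f2_family H' \<and> |H'| \<le>o |H|"
proof -
  obtain b where b: "\<And>h. h \<in> H \<Longrightarrow> \<forall>\<^sub>\<infinity>n. h n \<le> b n"
    using assms by (auto simp: f1_family_def bounded_family_def)
  obtain g :: "nat \<Rightarrow> nat" where g: "filterlim g at_top sequentially"
    and *: "\<And>X s. infinite X \<Longrightarrow> \<forall>n. finite (s n) \<and> card (s n) \<le> g n \<Longrightarrow>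
      \<exists>h\<in>H. \<exists>\<^sub>\<infinity>n. n \<in> X \<and> h n \<notin> s n"
    using assms unfolding f1_family_def by blast
  \<comment> \<open>The product counts the functions on \<open>{..x}\<close> below \<open>b\<close>;
    the factor \<open>Suc x\<close> will bound the number of guesses made from each past.\<close>
  have "\<exists>y>x. (\<Prod>i\<le>x. Suc (b i)) * Suc x \<le> g y" for x
  proof -
    have "eventually (\<lambda>y. (\<Prod>i\<le>x. Suc (b i)) * Suc x \<le> g y) sequentially"
      using g by (simp add: filterlim_at_top)
    then show ?thesis using eventually_gt_at_top[of x] eventually_happens' sequentially_bot
      by (metis (mono_tags, lifting) eventually_conj)
  qed
  then obtain nxt where nxt: "\<And>x. x < nxt x" "\<And>x. (\<Prod>i\<le>x. Suc (b i)) * Suc x \<le> g (nxt x)"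
    by metis
  define j where "j = rec_nat 0 (\<lambda>_ x. nxt x)"
  have j: "j 0 = 0" "\<And>n. j (Suc n) = nxt (j n)" by (simp_all add: j_def)
  have mono: "strict_mono j" by (rule strict_monoI_Suc) (simp add: j nxt)
  have inj: "inj j" using mono by (rule strict_mono_imp_inj_on)
  \<comment> \<open>Truncation alters only finitely many values of \<open>c h\<close> and makes
    every past bounded by \<open>b\<close>.\<close>
  define c where "c h n = min (h (j n)) (b (j n))" for h n
  have "f2_family (c ` H)"
    unfolding f2_family_def
  proof (intro conjI exI[of _ "\<lambda>n. n"] allI impI)
    show "bounded_family (c ` H)"
      unfolding bounded_family_def by (intro exI[of _ "b \<circ> j"]) (auto simp: c_def)
    show "filterlim (\<lambda>n. n) at_top (sequentially :: nat filter)" by (rule filterlim_ident)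
    fix X :: "nat set" and \<pi> :: "nat \<Rightarrow> nat list \<Rightarrow> nat set"
    assume "infinite X \<and> (\<forall>n t. length t = n \<longrightarrow> finite (\<pi> n t) \<and> card (\<pi> n t) \<le> n)"
    then have X: "infinite X" and fin: "\<And>t. finite (\<pi> (length t) t)"
      and crd: "\<And>t. card (\<pi> (length t) t) \<le> length t" by auto
    \<comment> \<open>The possible pasts along \<open>j\<close>. They are read off functions on all
      of \<open>{..j (n - 1)}\<close>, so that their number is at most the product used in choosing
      \<open>nxt\<close>.\<close>
    define past where "past n = (\<lambda>f :: nat \<Rightarrow> nat. map (f \<circ> j) [0..<n]) ` PiE {..j (n - 1)} (\<lambda>y. {..b y})" for n
    have fin_past: "finite (past n)" for n
      unfolding past_def by (intro finite_imageI finite_PiE) auto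
    have len_past: "length t = n" if "t \<in> past n" for t n using that by (auto simp: past_def)
    have card_past: "card (past n) \<le> (\<Prod>i\<le>j (n - 1). Suc (b i))" for n
    proof -
      have "card (past n) \<le> card (PiE {..j (n - 1)} (\<lambda>y. {..b y}))"
        unfolding past_def by (intro card_image_le finite_PiE) auto
      then show ?thesis by (simp add: card_PiE)
    qed
    define s where "s y = (if y \<in> range j then \<Union>t\<in>past (inv j y). \<pi> (inv j y) t else {})" for y
    have s_j: "s (j n) = (\<Union>t\<in>past n. \<pi> n t)" for n by (simp add: s_def inj)
    have "finite (s (j n)) \<and> card (s (j n)) \<le> g (j n)" for n
    proof
      show "finite (s (j n))" unfolding s_j using fin_past fin len_past by blast
      have "card (s (j n)) \<le> (\<Sum>t\<in>past n. card (\<pi> n t))"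
        unfolding s_j by (rule card_UN_le[OF fin_past])
      also have "\<dots> \<le> (\<Sum>t\<in>past n. n)" using crd len_past by (intro sum_mono) blast
      also have "\<dots> \<le> g (j n)"
      \<comment> \<open>For \<open>n = 0\<close> the sum vanishes; for \<open>n = Suc k\<close>, k
        \<le> j k yields n \<le> Suc (j k).\<close>
      proof (cases n)
        case (Suc k)
        have "card (past n) * n \<le> (\<Prod>i\<le>j k. Suc (b i)) * Suc (j k)"
          using card_past[of n] strict_mono_imp_increasing[OF mono, of k] Suc
          by (intro mult_mono) auto
        also have "\<dots> \<le> g (j n)" using nxt(2)[of "j k"] by (simp add: j Suc)
        finally show ?thesis by simp
      qed simp
      finally show "card (s (j n)) \<le> g (j n)" .
    qed
    then have "finite (s y) \<and> card (s y) \<le> g y" for y by (cases "y \<in> range j") (auto simp: s_def)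
    moreover have "infinite (j ` X)" using X inj by (simp add: finite_image_iff inj_on_subset)
    ultimately obtain h where h: "h \<in> H" "\<exists>\<^sub>\<infinity>y. y \<in> j ` X \<and> h y \<notin> s y"
      using *[of "j ` X" s] by blast
    have "\<exists>\<^sub>\<infinity>y. (y \<in> j ` X \<and> h y \<notin> s y) \<and> h y \<le> b y"
      using h(2) b[OF h(1)] by (rule frequently_eventually_frequently)
    \<comment> \<open>Where \<open>h y\<close> obeys \<open>b\<close>, truncation has no effect. The
      actual past of \<open>c h\<close> lies in \<open>past n\<close>, so a value outside
      \<open>s (j n)\<close> also escapes the guesses made from that past.\<close>
    moreover have "{y. (y \<in> j ` X \<and> h y \<notin> s y) \<and> h y \<le> b y}
      \<subseteq> j ` {n. n \<in> X \<and> c h n \<notin> \<pi> n (map (c h) [0..<n])}"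
    proof clarify
      fix n assume n: "n \<in> X" "h (j n) \<notin> s (j n)" "h (j n) \<le> b (j n)"
      have "map (c h) [0..<n] \<in> past n"
        unfolding past_def
      proof
        show "(\<lambda>y\<in>{..j (n - 1)}. min (h y) (b y)) \<in> PiE {..j (n - 1)} (\<lambda>y. {..b y})" by auto
        show "map (c h) [0..<n] = map ((\<lambda>y\<in>{..j (n - 1)}. min (h y) (b y)) \<circ> j) [0..<n]"
          using strict_mono_less_eq[OF mono] by (auto simp: c_def)
      qed
      then have "c h n \<notin> \<pi> n (map (c h) [0..<n])" using n by (auto simp: s_j c_def)
      with n(1) show "j n \<in> j ` {n. n \<in> X \<and> c h n \<notin> \<pi> n (map (c h) [0..<n])}" by blast
    qed
    ultimately have "\<exists>\<^sub>\<infinity>n. n \<in> X \<and> c h n \<notin> \<pi> n (map (c h) [0..<n])"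
      by (rule frequently_cofinite_image)
    with h(1) show "\<exists>h\<in>c ` H. \<exists>\<^sub>\<infinity>n. n \<in> X \<and> h n \<notin> \<pi> n (map h [0..<n])" by blast
  qed
  then show ?thesis using card_of_image by blast
qed

text \<open>Among \<open>n\<close> candidates for the restriction of \<open>h\<close> to an interval of length more than
  \<open>n\<^sup>2\<close>, there is a position at which no two candidates differ for the first time. At this position
  the past of \<open>h\<close> determines its value.\<close>

lemma f1_family_from_e_ubd_family:
  assumes "e_ubd_family H"
  shows "\<exists>H'. f1_family H' \<and> |H'| \<le>o |H|"
proof -
  obtain b where b: "\<And>h. h \<in> H \<Longrightarrow> \<forall>\<^sub>\<infinity>n. h n \<le> b n"
    using assms by (auto simp: e_ubd_family_def bounded_family_def)
  \<comment> \<open>The length 3n^2 + 3n + 1 exceeds n^2, a bound on the number of pairs of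
    candidates in \<open>s n\<close>.\<close>
  define I where "I n = {n ^ 3..<Suc n ^ 3}" for n :: nat
  define c where "c h n = list_encode (map h [n ^ 3..<Suc n ^ 3])" for h n
  define V where "V d n y = list_decode d ! (y - n ^ 3)" for d n y
  have V_c: "V (c h n) n y = h y" if "y \<in> I n" for h n y
  proof -
    have "y - n ^ 3 < Suc n ^ 3 - n ^ 3" "n ^ 3 + (y - n ^ 3) = y" using that by (auto simp: I_def)
    then show ?thesis by (simp add: V_def c_def nth_upt del: power_Suc upt_Suc)
  qed
  have I_disj: "n = n'" if "y \<in> I n" "y \<in> I n'" for y n n'
  proof -
    have *: "\<not> a < a'" if "y \<in> I a" "y \<in> I a'" for a a'
    proof
      assume "a < a'"
      then have "Suc a ^ 3 \<le> a' ^ 3" by (intro power_mono) auto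
      with that show False by (auto simp: I_def)
    qed
    from *[OF that] *[OF that(2,1)] show ?thesis by simp
  qed
  have card_I: "n * n < card (I n)" for n
    by (simp add: I_def power3_eq_cube algebra_simps)
  have "f1_family (c ` H)"
    unfolding f1_family_def
  proof (intro conjI exI[of _ "\<lambda>n. n"] allI impI)
    \<comment> \<open>Once \<open>h\<close> obeys \<open>b\<close> on \<open>I n\<close>, its
      restriction is one of these finitely many lists, which bounds its code.\<close>
    define L where "L n = {l. set l \<subseteq> {..Max (b ` I n)} \<and> length l = Suc n ^ 3 - n ^ 3}" for n
    have fin_L: "finite (L n)" for n unfolding L_def by (rule finite_lists_length_eq) simp
    have "\<forall>\<^sub>\<infinity>n. c h n \<le> Max (list_encode ` L n)" if h: "h \<in> H" for h
    proof -
      obtain N where N: "\<And>n. N \<le> n \<Longrightarrow> h n \<le> b n"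
        using b[OF h] by (auto simp: cofinite_eq_sequentially eventually_sequentially)
      have "c h n \<le> Max (list_encode ` L n)" if "N \<le> n" for n
      proof -
        have "h y \<le> Max (b ` I n)" if y: "y \<in> I n" for y
        proof -
          have "n \<le> n ^ 3" by (cases n) (auto simp: power3_eq_cube)
          then have "h y \<le> b y" using y \<open>N \<le> n\<close> by (intro N) (simp add: I_def)
          also have "b y \<le> Max (b ` I n)" using y by (intro Max_ge) (auto simp: I_def)
          finally show ?thesis .
        qed
        then have "map h [n ^ 3..<Suc n ^ 3] \<in> L n"
          by (auto simp: L_def I_def simp del: power_Suc upt_Suc)
        then show ?thesis unfolding c_def using fin_L by (intro Max_ge) auto
      qed
      then show ?thesis by (auto simp: cofinite_eq_sequentially eventually_sequentially)
    qed
    then show "bounded_family (c ` H)"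
      unfolding bounded_family_def by (intro exI[of _ "\<lambda>n. Max (list_encode ` L n)"]) auto
    show "filterlim (\<lambda>n. n) at_top (sequentially :: nat filter)" by (rule filterlim_ident)
    fix X :: "nat set" and s :: "nat \<Rightarrow> nat set"
    assume "infinite X \<and> (\<forall>n. finite (s n) \<and> card (s n) \<le> n)"
    then have X: "infinite X" and fin: "\<And>n. finite (s n)" and crd: "\<And>n. card (s n) \<le> n" by auto
    \<comment> \<open>Positions of first difference. For pairs that never differ,
      \<open>LEAST\<close> yields an arbitrary number; this is harmless, as only the size of
      \<open>D n\<close> and the membership of true first differences matter.\<close>
    define D where "D n = (\<lambda>(d, e). LEAST y. n ^ 3 \<le> y \<and> V d n y \<noteq> V e n y) ` (s n \<times> s n)" for n
    have "\<exists>y\<in>I n. y \<notin> D n" for n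
    proof -
      have "card (D n) \<le> card (s n \<times> s n)" unfolding D_def by (intro card_image_le) (simp add: fin)
      also have "\<dots> \<le> n * n" using crd by (simp add: card_cartesian_product mult_mono)
      finally have "card (D n) < card (I n)" using card_I[of n] by linarith
      moreover have "finite (D n)" by (simp add: D_def fin)
      ultimately show ?thesis by (meson card_mono leD subsetI)
    qed
    then obtain x where x: "\<And>n. x n \<in> I n" "\<And>n. x n \<notin> D n" by metis
    have inj: "inj x" by (rule injI) (metis I_disj x(1))
    \<comment> \<open>Some candidate compatible with the past \<open>t\<close> on the part of
      \<open>I n\<close> before \<open>x n\<close>; one exists whenever \<open>c h n\<close> is
      itself a candidate.\<close>
    define guess where "guess n t = (SOME d. d \<in> s n \<and> (\<forall>y\<in>{n ^ 3..<x n}. t ! y = V d n y))" for n t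
    have guess: "V (guess n (map h [0..<x n])) n (x n) = h (x n)" if "c h n \<in> s n" for h n
    proof -
      have below: "V (c h n) n y = h y" if "y \<in> {n ^ 3..<x n}" for y
        using V_c[of y n h] x(1)[of n] that by (auto simp: I_def)
      define d where "d = guess n (map h [0..<x n])"
      have "d \<in> s n \<and> (\<forall>y\<in>{n ^ 3..<x n}. map h [0..<x n] ! y = V d n y)"
        unfolding d_def guess_def by (rule someI[of _ "c h n"]) (use that below in auto)
      then have d: "d \<in> s n" "\<And>y. n ^ 3 \<le> y \<Longrightarrow> y < x n \<Longrightarrow> V d n y = V (c h n) n y"
        by (auto simp: below)
      \<comment> \<open>Both candidates agree before \<open>x n\<close>, so a disagreement there
        would be their first, putting \<open>x n\<close> into \<open>D n\<close>.\<close>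
      have "V d n (x n) = V (c h n) n (x n)"
      proof (rule ccontr)
        assume ne: "V d n (x n) \<noteq> V (c h n) n (x n)"
        have "(LEAST y. n ^ 3 \<le> y \<and> V d n y \<noteq> V (c h n) n y) = x n"
        proof (rule Least_equality)
          show "n ^ 3 \<le> x n \<and> V d n (x n) \<noteq> V (c h n) n (x n)" using ne x(1)[of n] by (simp add: I_def)
          show "x n \<le> y" if "n ^ 3 \<le> y \<and> V d n y \<noteq> V (c h n) n y" for y
            using d(2)[of y] that by (meson not_le)
        qed
        then have "x n \<in> D n" unfolding D_def using d(1) that by force
        with x(2) show False by blast
      qed
      then show ?thesis using V_c x(1) by (simp add: d_def)
    qed
    \<comment> \<open>Only positions in the range of \<open>x\<close> are tested, so the values of
      \<open>inv x\<close> elsewhere are irrelevant.\<close>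
    define \<pi> where "\<pi> y t = V (guess (inv x y) t) (inv x y) y" for y t
    have "infinite (x ` X)" using X inj by (simp add: finite_image_iff inj_on_subset)
    then obtain h where h: "h \<in> H" "\<exists>\<^sub>\<infinity>y. y \<in> x ` X \<and> h y \<noteq> \<pi> y (map h [0..<y])"
      using assms unfolding e_ubd_family_def by blast
    have "{y. y \<in> x ` X \<and> h y \<noteq> \<pi> y (map h [0..<y])} \<subseteq> x ` {n. n \<in> X \<and> c h n \<notin> s n}"
      using guess by (auto simp: \<pi>_def inj)
    then have "\<exists>\<^sub>\<infinity>n. n \<in> X \<and> c h n \<notin> s n"
      by (rule frequently_cofinite_image[OF h(2)])
    with h(1) show "\<exists>h\<in>c ` H. \<exists>\<^sub>\<infinity>n. n \<in> X \<and> h n \<notin> s n" by blast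
  qed
  then show ?thesis using card_of_image by blast
qed


section \<open>Generated filters and the Cantor space\<close>

lemma omega_filterD:
  assumes "omega_filter F"
  shows "UNIV \<in> F" "A \<in> F \<Longrightarrow> B \<in> F \<Longrightarrow> A \<inter> B \<in> F" "A \<in> F \<Longrightarrow> infinite A"
    "A \<in> F \<Longrightarrow> A \<subseteq> B \<Longrightarrow> B \<in> F" "finite (- A) \<Longrightarrow> A \<in> F"
proof -
  have "finite (- UNIV :: nat set)" by simp
  then show "UNIV \<in> F" using assms unfolding omega_filter_def by blast
qed (use assms in \<open>unfold omega_filter_def, blast+\<close>)

lemma generated_filter_subset:
  assumes "omega_filter F" "\<X> \<subseteq> F"
  shows "generated_filter \<X> \<subseteq> F"
  using assms by (auto simp: generated_filter_def)

lemma subset_generated_filter: "\<X> \<subseteq> generated_filter \<X>"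
  by (auto simp: generated_filter_def)

text \<open>The closure properties pass to intersections of filters; the enclosing \<open>F\<close>
  guarantees that all members are infinite.\<close>

lemma omega_filter_generated_filter:
  assumes "omega_filter F" "\<X> \<subseteq> F"
  shows "omega_filter (generated_filter \<X>)"
proof -
  have "\<forall>A\<in>generated_filter \<X>. infinite A"
    using generated_filter_subset[OF assms] omega_filterD(3)[OF assms(1)] by blast
  moreover have "\<forall>A\<in>generated_filter \<X>. \<forall>B\<in>generated_filter \<X>. A \<inter> B \<in> generated_filter \<X>"
    unfolding generated_filter_def using omega_filterD(2) by blast
  moreover have "\<forall>A\<in>generated_filter \<X>. \<forall>B. A \<subseteq> B \<longrightarrow> B \<in> generated_filter \<X>"
    unfolding generated_filter_def using omega_filterD(4) by blast
  moreover have "\<forall>A. finite (- A) \<longrightarrow> A \<in> generated_filter \<X>"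
    unfolding generated_filter_def using omega_filterD(5) by blast
  ultimately show ?thesis unfolding omega_filter_def by blast
qed

text \<open>The sets that almost contain \<open>Z\<close> form a filter, so it suffices to check the
  generators.\<close>

lemma diagonalizes_generated_filter:
  assumes "infinite Z" "\<And>A. A \<in> \<X> \<Longrightarrow> Z \<subseteq>\<^sup>* A"
  shows "diagonalizes Z (generated_filter \<X>)"
proof -
  have "omega_filter {A. Z \<subseteq>\<^sup>* A}"
    unfolding omega_filter_def
  proof (intro conjI ballI allI impI)
    fix A B assume "A \<in> {A. Z \<subseteq>\<^sup>* A}" "B \<in> {A. Z \<subseteq>\<^sup>* A}"
    then show "A \<inter> B \<in> {A. Z \<subseteq>\<^sup>* A}" by (simp add: almost_subset_def Diff_Int)
  next
    fix A B assume "A \<in> {A. Z \<subseteq>\<^sup>* A}" "A \<subseteq> B"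
    then show "B \<in> {A. Z \<subseteq>\<^sup>* A}"
      by (simp add: almost_subset_def) (meson Diff_mono finite_subset order_refl)
  next
    fix A :: "nat set" assume "finite (- A)"
    then show "A \<in> {A. Z \<subseteq>\<^sup>* A}" by (simp add: almost_subset_def Diff_eq)
  next
    fix A assume "A \<in> {A. Z \<subseteq>\<^sup>* A}"
    then show "infinite A" using assms(1) by (auto simp: almost_subset_def dest: finite_Diff2)
  qed
  then have "generated_filter \<X> \<subseteq> {A. Z \<subseteq>\<^sup>* A}" using assms by (intro generated_filter_subset) auto
  then show ?thesis using assms(1) by (auto simp: diagonalizes_def)
qed

section \<open>Compactness in the Cantor space\<close>

lemma cantor_space_eq: "cantor_space = euclidean"
proof -
  have "discrete_topology (UNIV :: bool set) = euclidean" by (simp add: topology_eq open_discrete)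
  then show ?thesis by (simp add: cantor_space_def euclidean_product_topology)
qed

lemma compact_UNIV_cantor: "compact (UNIV :: (nat \<Rightarrow> bool) set)"
proof -
  have "compact_space cantor_space"
    unfolding cantor_space_def by (simp add: compact_space_product_topology compact_space_discrete_topology)
  then show ?thesis by (simp add: cantor_space_eq compact_space_def)
qed

lemma clopen_coordinate:
  fixes n :: nat
  shows "open {u :: nat \<Rightarrow> bool. u n}" "closed {u :: nat \<Rightarrow> bool. u n}"
proof -
  have "open ((\<lambda>u :: nat \<Rightarrow> bool. u n) -` {True})"
    by (intro open_vimage continuous_on_product_coordinates) (simp add: open_discrete)
  then show "open {u :: nat \<Rightarrow> bool. u n}" by (simp add: vimage_def)
  have "closed ((\<lambda>u :: nat \<Rightarrow> bool. u n) -` {True})"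
    by (intro closed_vimage continuous_on_product_coordinates) (auto simp: closed_def open_discrete)
  then show "closed {u :: nat \<Rightarrow> bool. u n}" by (simp add: vimage_def)
qed

text \<open>The open sets \<open>{u. u z}\<close> with z \<ge> m cover \<open>D\<close>; a finite
  subcover bounds the \<open>z\<close> required.\<close>

lemma compact_infinite_sets_meet_interval:
  assumes "compact D" "\<And>u. u \<in> D \<Longrightarrow> infinite (Collect u)"
  shows "\<exists>M>m. \<forall>u\<in>D. \<exists>z\<in>{m..<M :: nat}. u z"
proof -
  have "D \<subseteq> (\<Union>z\<in>{m..}. {u. u z})"
    using assms(2) by (fastforce simp: infinite_nat_iff_unbounded_le)
  then obtain Z where Z: "Z \<subseteq> {m..}" "finite Z" "D \<subseteq> (\<Union>z\<in>Z. {u. u z})"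
    using compactE_image[OF assms(1), of "{m..}" "\<lambda>z. {u. u z}"] clopen_coordinate(1) by metis
  define M where "M = Suc (Max (insert m Z))"
  have "m < M" unfolding M_def using Z(2) by (simp add: less_Suc_eq_le)
  moreover have "Z \<subseteq> {m..<M}" using Z(1,2) by (auto simp: M_def less_Suc_eq_le)
  ultimately show ?thesis using Z(3) by blast
qed

text \<open>On characteristic functions this is intersection of sets, which is continuous in both
  arguments together.\<close>

lemma compact_inf_image:
  fixes C D :: "(nat \<Rightarrow> bool) set"
  assumes "compact C" "compact D"
  shows "compact ((\<lambda>(u, v) n. u n \<and> v n) ` (C \<times> D))"
proof (rule compact_continuous_image)
  show "compact (C \<times> D)" using assms by (rule compact_Times)
  have and_cont: "continuous_on (UNIV :: (bool \<times> bool) set) (\<lambda>(a, b). a \<and> b)"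
    using discrete_compact_finite_iff[of "UNIV :: (bool \<times> bool) set"]
    by (intro continuous_on_discrete) simp
  have "continuous_on (C \<times> D) (\<lambda>p. fst p n)" "continuous_on (C \<times> D) (\<lambda>p. snd p n)" for n
    by (rule continuous_on_compose2[OF continuous_on_product_coordinates[of n]
          continuous_on_fst[OF continuous_on_id] subset_UNIV],
        rule continuous_on_compose2[OF continuous_on_product_coordinates[of n]
          continuous_on_snd[OF continuous_on_id] subset_UNIV])
  then have "continuous_on (C \<times> D) (\<lambda>p. (fst p n, snd p n))" for n by (intro continuous_on_Pair)
  from continuous_on_compose2[OF and_cont this subset_UNIV]
  have "continuous_on (C \<times> D) (\<lambda>p. fst p n \<and> snd p n)" for n by simp
  then show "continuous_on (C \<times> D) (\<lambda>(u, v) n. u n \<and> v n)"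
    by (simp add: case_prod_unfold continuous_on_coordinatewise_then_product)
qed

text \<open>The intersections of at most \<open>k\<close> sets from \<open>C\<close> lie in a
  compact set of members of \<open>G\<close>. These are infinite, so a single interval meets all of
  them.\<close>

lemma common_point_in_interval:
  assumes G: "omega_filter G" and C: "closed C" "C \<subseteq> (\<lambda>A n. n \<in> A) ` G"
  shows "\<exists>M>m. \<forall>\<A>. finite \<A> \<and> card \<A> \<le> k \<and> (\<forall>A\<in>\<A>. (\<lambda>n. n \<in> A) \<in> C) \<longrightarrow>
           (\<exists>z\<in>{m..<M}. \<forall>A\<in>\<A>. z \<in> A)"
proof -
  \<comment> \<open>The added function represents \<open>UNIV\<close>; it pads families with fewer
    than \<open>k\<close> sets.\<close>
  define C' where "C' = insert (\<lambda>_. True) C"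
  have "compact C"
    using compact_Int_closed[OF compact_UNIV_cantor C(1)] by simp
  then have cpt: "compact C'" by (simp add: C'_def)
  have UNIV_G: "UNIV \<in> G" using G by (rule omega_filterD)
  have C'_G: "Collect u \<in> G" if "u \<in> C'" for u using that C(2) UNIV_G by (auto simp: C'_def)
  \<comment> \<open>\<open>D i\<close> consists of the intersections of \<open>i\<close> sets from
    \<open>C'\<close>, repetitions allowed.\<close>
  define D where "D = rec_nat {\<lambda>_. True} (\<lambda>_ E. (\<lambda>(u, v) n :: nat. u n \<and> v n) ` (C' \<times> E))"
  have D: "D 0 = {\<lambda>_. True}" "D (Suc i) = (\<lambda>(u, v) n. u n \<and> v n) ` (C' \<times> D i)" for i
    by (simp_all add: D_def)
  have "compact (D i)" for i by (induction i) (simp_all add: D cpt compact_inf_image)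
  moreover have "Collect u \<in> G" if "u \<in> D i" for u i
    using that
  proof (induction i arbitrary: u)
    case 0
    then show ?case by (simp add: D UNIV_G)
  next
    case (Suc i)
    then obtain v w where vw: "u = (\<lambda>n. v n \<and> w n)" "v \<in> C'" "w \<in> D i" by (auto simp: D)
    then have "Collect v \<inter> Collect w \<in> G" using C'_G Suc.IH by (intro omega_filterD(2)[OF G])
    then show ?case by (simp add: vw(1) Collect_conj_eq)
  qed
  ultimately obtain M where M: "M > m" "\<forall>u\<in>D k. \<exists>z\<in>{m..<M}. u z"
    using compact_infinite_sets_meet_interval[of "D k" m] omega_filterD(3)[OF G] by blast
  have "(\<lambda>n. \<forall>A\<in>\<A>. n \<in> A) \<in> D i"
    if "finite \<A>" "card \<A> \<le> i" "\<forall>A\<in>\<A>. (\<lambda>n. n \<in> A) \<in> C'" for \<A> i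
    using that
  proof (induction i arbitrary: \<A>)
    case 0
    then show ?case by (simp add: D)
  next
    case (Suc i)
    show ?case
    proof (cases "\<A> = {}")
      case True
      have "(\<lambda>_. True) \<in> D i" using Suc.IH[of "{}"] by simp
      then show ?thesis unfolding True D by (intro image_eqI[of _ _ "(\<lambda>_. True, \<lambda>_. True)"]) (auto simp: C'_def)
    next
      case False
      then obtain B where B: "B \<in> \<A>" by blast
      have "(\<lambda>n. \<forall>A\<in>\<A> - {B}. n \<in> A) \<in> D i"
        using Suc.prems B by (intro Suc.IH) (auto simp: card_Diff_singleton)
      then show ?thesis unfolding D using Suc.prems B
        by (intro image_eqI[of _ _ "(\<lambda>n. n \<in> B, \<lambda>n. \<forall>A\<in>\<A> - {B}. n \<in> A)"]) auto
    qed
  qed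
  then have "\<exists>z\<in>{m..<M}. \<forall>A\<in>\<A>. z \<in> A"
    if "finite \<A> \<and> card \<A> \<le> k \<and> (\<forall>A\<in>\<A>. (\<lambda>n. n \<in> A) \<in> C)" for \<A>
    using that M(2)[rule_format, of "\<lambda>n. \<forall>A\<in>\<A>. n \<in> A"] by (simp add: C'_def)
  then show ?thesis using M(1) by blast
qed


section \<open>Filters and slaloms\<close>

text \<open>The traces of large sets on the intervals \<open>[m n, m (n + 1))\<close> are such that any \<open>n\<close> of them
  have a common point, so a slalom capturing all traces yields a diagonalizing set.\<close>

lemma f1_family_from_f_family:
  assumes "f_family \<X>"
  shows "\<exists>H. f1_family H \<and> |H| \<le>o |\<X>|"
proof -
  obtain G where G: "fsigma_filter G" "generated_filter \<X> \<subseteq> G"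
    using assms by (auto simp: f_family_def)
  have nontriv: "\<nexists>Z. diagonalizes Z (generated_filter \<X>)"
    using assms by (simp add: f_family_def nontrivial_filter_def)
  obtain C where C: "\<And>n. closed (C n)" "\<And>n. C n \<subseteq> C (Suc n)" "\<Union> (range C) = (\<lambda>A n. n \<in> A) ` G"
    using G(1) by (auto simp: fsigma_filter_def cantor_space_eq fsigma_in_ascending)
  define meets where "meets k m M \<longleftrightarrow>
    (\<forall>\<A>. finite \<A> \<and> card \<A> \<le> k \<and> (\<forall>A\<in>\<A>. (\<lambda>n. n \<in> A) \<in> C k) \<longrightarrow>
      (\<exists>z\<in>{m..<M}. \<forall>A\<in>\<A>. z \<in> A))" for k m M
  have "\<exists>M>m. meets k m M" for k m
    unfolding meets_def using G(1) C(1,3)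
    by (intro common_point_in_interval[of G]) (auto simp: fsigma_filter_def)
  then have "\<forall>k m. \<exists>M. m < M \<and> meets k m M" by blast
  then obtain nxt where "\<forall>k m. m < nxt k m \<and> meets k m (nxt k m)" unfolding choice_iff by blast
  then have nxt: "\<And>k m. m < nxt k m" "\<And>k m. meets k m (nxt k m)" by blast+
  define m where "m = rec_nat 0 nxt"
  have m: "m (Suc n) = nxt n (m n)" for n by (simp add: m_def)
  have mono: "strict_mono m" by (rule strict_monoI_Suc) (simp add: m nxt)
  define I where "I n = {m n..<m (Suc n)}" for n
  have I_disj: "n = n'" if "y \<in> I n" "y \<in> I n'" for y n n'
  proof -
    have *: "\<not> a < a'" if "y \<in> I a" "y \<in> I a'" for a a'
    proof
      assume "a < a'"
      then have "m (Suc a) \<le> m a'" using strict_mono_less_eq[OF mono] by simp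
      with that show False by (auto simp: I_def)
    qed
    from *[OF that] *[OF that(2,1)] show ?thesis by simp
  qed
  define c where "c A n = set_encode (A \<inter> I n)" for A n
  have c_eq: "A \<inter> I n = B \<inter> I n" if "c A n = c B n" for A B n
    using that set_encode_eq[of "A \<inter> I n" "B \<inter> I n"] by (simp add: c_def I_def)
  have "f1_family (c ` \<X>)"
    unfolding f1_family_def
  proof (intro conjI exI[of _ "\<lambda>n. n"] allI impI)
    have "c A n \<le> set_encode (I n)" for A n
      unfolding c_def set_encode_def by (intro sum_mono2) (auto simp: I_def)
    then show "bounded_family (c ` \<X>)"
      unfolding bounded_family_def by (intro exI[of _ "\<lambda>n. set_encode (I n)"]) auto
    show "filterlim (\<lambda>n. n) at_top (sequentially :: nat filter)" by (rule filterlim_ident)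
    fix X :: "nat set" and s :: "nat \<Rightarrow> nat set"
    assume "infinite X \<and> (\<forall>n. finite (s n) \<and> card (s n) \<le> n)"
    then have X: "infinite X" and fin: "\<And>n. finite (s n)" and crd: "\<And>n. card (s n) \<le> n" by auto
    have "\<exists>z\<in>I n. \<forall>A. (\<lambda>n. n \<in> A) \<in> C n \<and> c A n \<in> s n \<longrightarrow> z \<in> A" for n
    proof -
      \<comment> \<open>Infinitely many sets may share a trace; one representative per trace leaves
        at most \<open>n\<close> sets to intersect.\<close>
      define rep where "rep d = (SOME A. (\<lambda>n. n \<in> A) \<in> C n \<and> c A n = d)" for d
      define S where "S = {d \<in> s n. \<exists>A. (\<lambda>n. n \<in> A) \<in> C n \<and> c A n = d}"
      have rep: "(\<lambda>n. n \<in> rep d) \<in> C n \<and> c (rep d) n = d" if "d \<in> S" for d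
      proof -
        have "\<exists>A. (\<lambda>n. n \<in> A) \<in> C n \<and> c A n = d" using that by (simp add: S_def)
        then show ?thesis unfolding rep_def by (rule someI_ex)
      qed
      have "card (rep ` S) \<le> card S" using fin by (intro card_image_le) (simp add: S_def)
      also have "card S \<le> card (s n)" using fin by (intro card_mono) (auto simp: S_def)
      finally have "card (rep ` S) \<le> n" using crd[of n] by linarith
      moreover have "finite (rep ` S)" using fin by (simp add: S_def)
      moreover have "\<forall>A\<in>rep ` S. (\<lambda>n. n \<in> A) \<in> C n" using rep by blast
      ultimately have "\<exists>z\<in>I n. \<forall>A\<in>rep ` S. z \<in> A"
        using nxt(2)[of n "m n"] unfolding meets_def I_def m by blast
      then obtain z where z: "z \<in> I n" "\<forall>A\<in>rep ` S. z \<in> A" by blast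
      have "z \<in> A" if "(\<lambda>n. n \<in> A) \<in> C n" "c A n \<in> s n" for A
      proof -
        have "c A n \<in> S" using that by (auto simp: S_def)
        then have "z \<in> rep (c A n)" "c (rep (c A n)) n = c A n" using z(2) rep by auto
        then show ?thesis using c_eq[of "rep (c A n)" n A] z(1) by blast
      qed
      with z(1) show ?thesis by blast
    qed
    then obtain z where z: "\<And>n. z n \<in> I n"
      "\<And>n A. (\<lambda>n. n \<in> A) \<in> C n \<Longrightarrow> c A n \<in> s n \<Longrightarrow> z n \<in> A" by metis
    have inj: "inj z" by (rule injI) (metis I_disj z(1))
    have "infinite (z ` X)" using X inj by (simp add: finite_image_iff inj_on_subset)
    \<comment> \<open>The chosen points do not diagonalize the filter, so some generator omits
      infinitely many of them.\<close>
    then obtain A where A: "A \<in> \<X>" "infinite (z ` X - A)"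
      using diagonalizes_generated_filter[of "z ` X" \<X>] nontriv by (auto simp: almost_subset_def)
    have "A \<in> G" using A(1) subset_generated_filter G(2) by blast
    then have "(\<lambda>n. n \<in> A) \<in> \<Union> (range C)" by (simp add: C(3))
    then obtain k where "(\<lambda>n. n \<in> A) \<in> C k" by blast
    then have in_C: "(\<lambda>n. n \<in> A) \<in> C n" if "k \<le> n" for n
      using lift_Suc_mono_le[of C, OF C(2) that] by blast
    \<comment> \<open>From \<open>k\<close> on, \<open>A\<close> lies in \<open>C n\<close>, so
      omitting \<open>z n\<close> forces its trace out of \<open>s n\<close>.\<close>
    have "z ` X - A \<subseteq> z ` ({..<k} \<union> {n. n \<in> X \<and> c A n \<notin> s n})"
      using z(2) in_C by (force simp: not_less)
    then have "infinite ({..<k} \<union> {n. n \<in> X \<and> c A n \<notin> s n})"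
      using A(2) by (meson finite_imageI finite_subset)
    then have "\<exists>\<^sub>\<infinity>n. n \<in> X \<and> c A n \<notin> s n" by (simp add: frequently_cofinite)
    with A(1) show "\<exists>h\<in>c ` \<X>. \<exists>\<^sub>\<infinity>n. n \<in> X \<and> h n \<notin> s n" by blast
  qed
  then show ?thesis using card_of_image by blast
qed

text \<open>The filter lives on the pairs \<open>(n, S)\<close> with \<open>S\<close> a possible value of a slalom at \<open>n\<close>, so a
  set diagonalizing it is a slalom on an infinite set of \<open>n\<close>.\<close>

lemma f_family_from_f1_family:
  assumes "f1_family H"
  shows "\<exists>\<X>. f_family \<X> \<and> |\<X>| \<le>o |H|"
proof -
  obtain b where b: "\<And>h. h \<in> H \<Longrightarrow> \<forall>\<^sub>\<infinity>n. h n \<le> b n"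
    using assms by (auto simp: f1_family_def bounded_family_def)
  obtain g :: "nat \<Rightarrow> nat" where g: "filterlim g at_top sequentially"
    and *: "\<And>X s. infinite X \<Longrightarrow> \<forall>n. finite (s n) \<and> card (s n) \<le> g n \<Longrightarrow>
      \<exists>h\<in>H. \<exists>\<^sub>\<infinity>n. n \<in> X \<and> h n \<notin> s n"
    using assms unfolding f1_family_def by blast
  define p where "p n S = prod_encode (n, set_encode S)" for n S
  have le_p: "n \<le> p n S" for n S by (simp add: p_def le_prod_encode_1)
  define W where "W n = {S. S \<subseteq> {..b n} \<and> card S \<le> g n}" for n
  have fin_W: "finite (W n)" for n
    by (rule finite_subset[of _ "Pow {..b n}"]) (auto simp: W_def)
  have fin_S: "finite S" if "S \<in> W n" for S n using that finite_subset by (auto simp: W_def)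
  have p_inj: "n = n' \<and> S = S'" if "p n S = p n' S'" "S \<in> W n" "S' \<in> W n'" for n S n' S'
    using that fin_S by (metis p_def Pair_inject prod_encode_eq set_encode_eq)
  \<comment> \<open>From \<open>k\<close> on, \<open>A\<close> contains every pair over some cone of
    supersets of a \<open>T\<close> of size at most \<open>k\<close>. Intersecting two such sets
    amounts to uniting the sets \<open>T\<close>.\<close>
  define E where "E k = {A. \<forall>n\<ge>k. \<exists>T\<in>{T. T \<subseteq> {..b n} \<and> card T \<le> k}. \<forall>S\<in>{S \<in> W n. T \<subseteq> S}. p n S \<in> A}" for k
  define G where "G = (\<Union>k. E k)"
  have filt: "omega_filter G"
    unfolding omega_filter_def
  proof (intro conjI ballI allI impI)
    fix A B assume "A \<in> G" "B \<in> G"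
    then obtain k l where "A \<in> E k" "B \<in> E l" by (auto simp: G_def)
    have "A \<inter> B \<in> E (k + l)"
      unfolding E_def
    proof (intro CollectI allI impI)
      fix n assume "k + l \<le> n"
      then have n: "k \<le> n" "l \<le> n" by auto
      obtain T where T: "T \<subseteq> {..b n}" "card T \<le> k" "\<forall>S\<in>{S \<in> W n. T \<subseteq> S}. p n S \<in> A"
        using \<open>A \<in> E k\<close> n by (auto simp: E_def)
      obtain U where U: "U \<subseteq> {..b n}" "card U \<le> l" "\<forall>S\<in>{S \<in> W n. U \<subseteq> S}. p n S \<in> B"
        using \<open>B \<in> E l\<close> n by (auto simp: E_def)
      show "\<exists>T\<in>{T. T \<subseteq> {..b n} \<and> card T \<le> k + l}. \<forall>S\<in>{S \<in> W n. T \<subseteq> S}. p n S \<in> A \<inter> B"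
        using T U card_Un_le[of T U] by (intro bexI[of _ "T \<union> U"]) auto
    qed
    then show "A \<inter> B \<in> G" by (auto simp: G_def)
  next
    fix A B assume "A \<in> G" "A \<subseteq> B"
    then obtain k where "A \<in> E k" by (auto simp: G_def)
    then have "B \<in> E k" using \<open>A \<subseteq> B\<close> unfolding E_def mem_Collect_eq by (meson subsetD)
    then show "B \<in> G" by (auto simp: G_def)
  next
    fix A :: "nat set" assume "finite (- A)"
    then obtain k where k: "\<And>x. x \<notin> A \<Longrightarrow> x < k" by (auto simp: finite_nat_set_iff_bounded)
    have "p n S \<in> A" if "k \<le> n" for n S using k[of "p n S"] le_p[of n S] that by linarith
    then have "A \<in> E k" by (auto simp: E_def intro!: exI[of _ "{}"])
    then show "A \<in> G" by (auto simp: G_def)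
  next
    fix A assume "A \<in> G"
    then obtain k where A: "A \<in> E k" by (auto simp: G_def)
    show "infinite A"
      unfolding infinite_nat_iff_unbounded_le
    proof
      fix N
      \<comment> \<open>Once k \<le> g n, the set \<open>T\<close> itself belongs to
        \<open>W n\<close>, so \<open>A\<close> contains its pair.\<close>
      have "eventually (\<lambda>n. k \<le> g n) sequentially" using g by (simp add: filterlim_at_top)
      then obtain n0 where n0: "\<And>n. n0 \<le> n \<Longrightarrow> k \<le> g n" by (auto simp: eventually_sequentially)
      define n where "n = max n0 (max k N)"
      have n: "k \<le> n" "N \<le> n" "k \<le> g n" using n0[of n] by (auto simp: n_def)
      then obtain T where T: "T \<subseteq> {..b n}" "card T \<le> k" "\<forall>S\<in>{S \<in> W n. T \<subseteq> S}. p n S \<in> A"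
        using A by (auto simp: E_def)
      then have "p n T \<in> A" using n by (auto simp: W_def)
      moreover have "N \<le> p n T" using le_p[of n T] n by simp
      ultimately show "\<exists>x\<ge>N. x \<in> A" by blast
    qed
  qed
  have fsigma: "fsigma_filter G"
  proof -
    \<comment> \<open>Only finitely many \<open>T\<close> lie below \<open>b n\<close>, so the union
      over them stays closed.\<close>
    define C where "C k = (\<Inter>n\<in>{k..}. \<Union>T\<in>{T. T \<subseteq> {..b n} \<and> card T \<le> k}.
      \<Inter>S\<in>{S \<in> W n. T \<subseteq> S}. {u :: nat \<Rightarrow> bool. u (p n S)})" for k
    have "closed (C k)" for k
      unfolding C_def
    proof (intro closed_INT closed_UN ballI clopen_coordinate)
      show "finite {T. T \<subseteq> {..b n} \<and> card T \<le> k}" for n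
        by (rule finite_subset[of _ "Pow {..b n}"]) auto
    qed
    then have "fsigma_in euclidean (\<Union>k. C k)"
      by (intro fsigma_in_Union) (auto intro: closed_imp_fsigma_in)
    moreover have C_E: "C k = {u. Collect u \<in> E k}" for k
      by (auto simp: C_def E_def)
    have "(\<lambda>A n. n \<in> A) ` G = (\<Union>k. C k)"
    proof (intro set_eqI iffI)
      show "u \<in> (\<Union>k. C k)" if "u \<in> (\<lambda>A n. n \<in> A) ` G" for u
        using that by (auto simp: C_E G_def)
      show "u \<in> (\<lambda>A n. n \<in> A) ` G" if "u \<in> (\<Union>k. C k)" for u
        using that by (intro image_eqI[of _ _ "Collect u"]) (auto simp: C_E G_def)
    qed
    ultimately show ?thesis using filt by (simp add: fsigma_filter_def cantor_space_eq)
  qed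
  \<comment> \<open>The pairs whose second component captures \<open>h n\<close>: almost inclusion
    in \<open>c h\<close> means capturing \<open>h\<close> with finitely many exceptions.\<close>
  define c where "c h = {x. \<exists>n S. S \<in> W n \<and> h n \<in> S \<and> x = p n S}" for h :: "nat \<Rightarrow> nat"
  have c_G: "c ` H \<subseteq> G"
  proof clarify
    fix h assume "h \<in> H"
    then obtain k where k: "\<And>n. k \<le> n \<Longrightarrow> h n \<le> b n"
      using b by (auto simp: cofinite_eq_sequentially eventually_sequentially)
    \<comment> \<open>\<open>Suc k\<close> leaves room for the singleton \<open>T = {h n}\<close>
      even if \<open>k\<close> is 0.\<close>
    have "c h \<in> E (Suc k)"
      unfolding E_def
    proof (intro CollectI allI impI)
      fix n assume "Suc k \<le> n"
      then show "\<exists>T\<in>{T. T \<subseteq> {..b n} \<and> card T \<le> Suc k}. \<forall>S\<in>{S \<in> W n. T \<subseteq> S}. p n S \<in> c h"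
        using k[of n] by (intro bexI[of _ "{h n}"]) (auto simp: c_def)
    qed
    then show "c h \<in> G" by (auto simp: G_def)
  qed
  have "\<not> diagonalizes Z (generated_filter (c ` H))" for Z
  proof
    assume "diagonalizes Z (generated_filter (c ` H))"
    then have Z: "infinite Z" "\<And>h. h \<in> H \<Longrightarrow> finite (Z - c h)"
      using subset_generated_filter[of "c ` H"] by (auto simp: diagonalizes_def almost_subset_def)
    \<comment> \<open>The empty slalom shows that \<open>H\<close> is nonempty; by
      \<open>h0\<close>, almost all points of \<open>Z\<close> code pairs. As each
      \<open>W n\<close> is finite, these involve infinitely many \<open>n\<close>.\<close>
    obtain h0 where h0: "h0 \<in> H" using *[of UNIV "\<lambda>_. {}"] by auto
    define X where "X = {n. \<exists>S\<in>W n. p n S \<in> Z}"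
    have "infinite X"
    proof
      assume "finite X"
      then have "finite (\<Union>n\<in>X. p n ` W n)" using fin_W by blast
      moreover have "Z \<subseteq> (Z - c h0) \<union> (\<Union>n\<in>X. p n ` W n)" by (auto simp: c_def X_def)
      ultimately show False using Z h0 by (meson finite_UnI finite_subset)
    qed
    define s where "s n = (if n \<in> X then SOME S. S \<in> W n \<and> p n S \<in> Z else {})" for n
    have s: "s n \<in> W n \<and> p n (s n) \<in> Z" if "n \<in> X" for n
      using that someI_ex[of "\<lambda>S. S \<in> W n \<and> p n S \<in> Z"] by (auto simp: s_def X_def)
    have "finite (s n) \<and> card (s n) \<le> g n" for n
      using s[of n] fin_S[of "s n" n] by (cases "n \<in> X") (auto simp: W_def s_def[of n])
    then obtain h where h: "h \<in> H" "infinite {n. n \<in> X \<and> h n \<notin> s n}"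
      using *[OF \<open>infinite X\<close>, of s] by (auto simp: frequently_cofinite)
    \<comment> \<open>Each \<open>n\<close> at which \<open>h\<close> escapes \<open>s n\<close>
      gives its own point of \<open>Z\<close> outside \<open>c h\<close>, and there are only
      finitely many such points.\<close>
    have "(\<lambda>n. p n (s n)) ` {n. n \<in> X \<and> h n \<notin> s n} \<subseteq> Z - c h"
      using s p_inj by (fastforce simp: c_def)
    moreover have "inj_on (\<lambda>n. p n (s n)) {n. n \<in> X \<and> h n \<notin> s n}"
      using s p_inj by (intro inj_onI) blast
    ultimately have "finite {n. n \<in> X \<and> h n \<notin> s n}"
      using Z(2)[OF h(1)] by (metis finite_imageD finite_subset)
    with h(2) show False by blast
  qed
  then have "f_family (c ` H)"
    unfolding f_family_def nontrivial_filter_def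
    using omega_filter_generated_filter[OF filt c_G] generated_filter_subset[OF filt c_G] fsigma c_G
      omega_filterD(3)[OF filt] by blast
  then show ?thesis using card_of_image by blast
qed


section \<open>Equality of the four cardinals\<close>

theorem proposition2p2:
  shows "card_f =o card_f1 \<and> card_f1 =o card_f2 \<and> card_f2 =o card_e_ubd"
proof -
  have "card_f \<le>o card_f1" unfolding card_f_def card_f1_def
    using f1_family_exists by (rule min_card_mono) (rule f_family_from_f1_family)
  moreover have "card_f1 \<le>o card_f" unfolding card_f_def card_f1_def
    using f_family_exists by (rule min_card_mono) (rule f1_family_from_f_family)
  moreover have f21: "card_f2 \<le>o card_f1" unfolding card_f2_def card_f1_def
    using f1_family_exists by (rule min_card_mono) (rule f2_family_from_f1_family)
  moreover have e2: "card_e_ubd \<le>o card_f2" unfolding card_f2_def card_e_ubd_def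
    using f2_family_exists
    by (rule min_card_mono) (metis e_ubd_family_if_f2_family card_of_mono1 order_refl)
  moreover have e1: "card_f1 \<le>o card_e_ubd" unfolding card_f1_def card_e_ubd_def
    using e_ubd_family_exists by (rule min_card_mono) (rule f1_family_from_e_ubd_family)
  ultimately show ?thesis
    using ordLeq_transitive[OF e1 e2] ordLeq_transitive[OF f21 e1] by (simp add: ordIso_iff_ordLeq)
qed

end
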